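(* For real $X\ge 1$ and $n\in\mathbb{N}$, let $S(n,X)$ denote the number of $2\times 2$ matrices $A$ with integer entries such that $\det(A)=n$ and every entry of $A$ has absolute value at most $X$. Then for all prime numbers $p$, \[ S(p,p^{1/2})=4\left(\frac{12}{\pi^2}-1\right)p+O\left(p^{1/2}\log p\right), \] and \[ S(p^2,p)=4\left(\frac{12}{\pi^2}-1\right)p^2+O\left(p\log p\right), \] with absolute implied constants. *)

theory Defs
  imports "HOL-Analysis.Analysis"
begin

definition matrix_count :: "nat \<Rightarrow> real \<Rightarrow> nat" where
  "matrix_count n X =
     card {A :: int ^ 2 ^ 2. det A = int n \<and> (\<forall>i j. real_of_int \<bar>A $ i $ j\<bar> \<le> X)}"

end

theory Submission
  imports Defs "HOL-Computational_Algebra.Squarefree" "HOL-Number_Theory.Number_Theory"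
begin

text \<open>
  Let \<open>n = p\<close> with \<open>K\<close> the integer part of \<open>sqrt p\<close>, or \<open>n = p\<^sup>2\<close> with \<open>K = p - 1\<close>; up to signs (and, for
  \<open>p\<^sup>2\<close>, up to the \<open>O(p)\<close> matrices with an entry \<open>p\<close> or \<open>- p\<close>) one has to count the solutions of
  \<open>a d + b c = n\<close> in \<open>{1..K}\<close>. A coprime pair \<open>(a, b)\<close> is determined by the unit \<open>b / a\<close> modulo \<open>n\<close>, and
  by Thue's lemma every unit is of the form \<open>b / a\<close> or \<open>- b / a\<close>. Both happen for one unit exactly
  when \<open>b / a = - d / c\<close>, that is \<open>a d + b c = n\<close>. By inclusion-exclusion the number of solutions is twice
  the number of coprime pairs minus the totient of \<open>n\<close>, without any error term, and Moebius inversion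
  gives \<open>6 / pi\<^sup>2 * K\<^sup>2 + O(K log K)\<close> coprime pairs.
\<close>

section \<open>The Moebius function and its divisor sums\<close>

definition moebius :: "nat \<Rightarrow> real" where
  "moebius n = (if squarefree n then (- 1) ^ card (prime_factors n) else 0)"

lemma abs_moebius_le_1: "\<bar>moebius n\<bar> \<le> 1"
  by (simp add: moebius_def power_abs)

lemma moebius_prime_mult:
  assumes "prime p" "\<not> p dvd d" "d > 0"
  shows "moebius (p * d) = - moebius d"
proof -
  have cop: "coprime p d"
    using assms by (simp add: prime_imp_coprime)
  have "prime_factors (p * d) = prime_factors p \<union> prime_factors d"
    using assms by (intro prime_factors_product) auto
  then have "prime_factors (p * d) = insert p (prime_factors d)"
    using assms by (simp add: prime_prime_factors)
  moreover have "p \<notin> prime_factors d"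
    using assms(2) by (auto dest: in_prime_factors_imp_dvd)
  moreover have "squarefree (p * d) \<longleftrightarrow> squarefree d"
    using cop assms(1) by (metis squarefree_mult_coprime squarefree_multD(2) squarefree_prime prime_imp_prime_elem)
  ultimately show ?thesis
    by (simp add: moebius_def)
qed

lemma moebius_square_dvd: "prime p \<Longrightarrow> p * p dvd d \<Longrightarrow> moebius d = 0"
  by (auto simp: moebius_def squarefree_def power2_eq_square)

text \<open>Fix a prime \<open>p\<close> dividing \<open>n\<close> and sort the divisors by whether
  \<open>p\<close> divides them not at all (\<open>A\<close>), exactly once (\<open>B\<close>) or at
  least twice (\<open>C\<close>). Multiplication by \<open>p\<close> maps \<open>A\<close> onto
  \<open>B\<close> and flips the sign of \<open>moebius\<close>, so these two sums cancel; on
  \<open>C\<close> the function vanishes.\<close>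

lemma sum_moebius_divisors:
  assumes "n > 0"
  shows "(\<Sum>d | d dvd n. moebius d) = (if n = 1 then 1 else 0)"
proof (cases "n = 1")
  case False
  then obtain p where p: "prime p" "p dvd n"
    using prime_factor_nat by blast
  define A where "A = {d. d dvd n \<and> \<not> p dvd d}"
  define B where "B = {d. d dvd n \<and> p dvd d \<and> \<not> p * p dvd d}"
  define C where "C = {d. d dvd n \<and> p * p dvd d}"
  have fin: "finite {d. d dvd n}"
    using assms by simp
  have fA: "finite A" "finite B" "finite C"
    by (rule finite_subset[OF _ fin]; force simp: A_def B_def C_def)+
  have B: "B = (*) p ` A"
  proof (intro equalityI subsetI)
    fix x assume "x \<in> B"
    then obtain y where "x = p * y" "p * y dvd n" "\<not> p * p dvd p * y"
      by (auto simp: B_def)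
    then show "x \<in> (*) p ` A"
      by (auto simp: A_def intro: dvd_mult_right)
  next
    fix x assume "x \<in> (*) p ` A"
    then obtain y where y: "x = p * y" "y dvd n" "\<not> p dvd y"
      by (auto simp: A_def)
    have "coprime p y"
      using p y by (simp add: prime_imp_coprime)
    then have "p * y dvd n"
      using p y by (simp add: divides_mult)
    then show "x \<in> B"
      using p y by (auto simp: B_def)
  qed
  have "{d. d dvd n} = A \<union> B \<union> C"
    using dvd_mult_left by (auto simp: A_def B_def C_def)
  moreover have "(A \<union> B) \<inter> C = {}" "A \<inter> B = {}"
    using dvd_mult_left by (auto simp: A_def B_def C_def)
  ultimately have "(\<Sum>d | d dvd n. moebius d) = sum moebius A + sum moebius B + sum moebius C"
    using fA by (simp add: sum.union_disjoint)
  moreover have "sum moebius C = 0"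
    using p by (intro sum.neutral) (auto simp: C_def moebius_square_dvd)
  moreover have "sum moebius B = (\<Sum>d\<in>A. moebius (p * d))"
    unfolding B using p by (subst sum.reindex) (auto simp: inj_on_def prime_gt_0_nat)
  moreover have "(\<Sum>d\<in>A. moebius (p * d)) = (\<Sum>d\<in>A. - moebius d)"
    using p assms by (intro sum.cong) (auto simp: A_def moebius_prime_mult dvd_pos_nat)
  ultimately show ?thesis
    using False by (simp add: sum_negf)
qed (simp add: moebius_def)

section \<open>Coprime pairs in a square box\<close>

lemma multiples_upto:
  fixes d :: nat
  assumes "d > 0"
  shows "{a \<in> {1..K}. d dvd a} = (*) d ` {1..K div d}"
proof (intro equalityI subsetI)
  fix x assume "x \<in> {a \<in> {1..K}. d dvd a}"
  then obtain y where "x = d * y" "1 \<le> d * y" "d * y \<le> K" by auto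
  then show "x \<in> (*) d ` {1..K div d}"
    using assms by (auto simp: less_eq_div_iff_mult_less_eq mult.commute intro!: imageI Suc_leI gr0I)
next
  fix x assume "x \<in> (*) d ` {1..K div d}"
  then show "x \<in> {a \<in> {1..K}. d dvd a}"
    using assms by (auto simp: less_eq_div_iff_mult_less_eq mult.commute)
qed

lemma card_multiples_upto:
  "d > 0 \<Longrightarrow> card {a \<in> {1..K}. d dvd a} = K div d" for d :: nat
  by (subst multiples_upto) (auto simp: card_image inj_on_def)

text \<open>Both sides sum over the pairs with \<open>d dvd k\<close> and \<open>k \<le> K\<close>;
  the right side writes \<open>k = d * m\<close>.\<close>

lemma sum_divisors_swap:
  fixes f g :: "nat \<Rightarrow> real"
  shows "(\<Sum>k=1..K. f k * (\<Sum>d | d dvd k. g d)) = (\<Sum>d=1..K. g d * (\<Sum>m=1..K div d. f (d * m)))"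
proof -
  have "(\<Sum>k=1..K. f k * (\<Sum>d | d dvd k. g d)) = (\<Sum>k=1..K. \<Sum>d | d \<in> {1..K} \<and> d dvd k. f k * g d)"
    unfolding sum_distrib_left
    by (intro sum.cong refl) (auto dest: dvd_imp_le intro!: Suc_leI gr0I)
  also have "\<dots> = (\<Sum>d=1..K. \<Sum>k | k \<in> {1..K} \<and> d dvd k. f k * g d)"
    by (rule sum.swap_restrict) auto
  also have "\<dots> = (\<Sum>d=1..K. g d * (\<Sum>m=1..K div d. f (d * m)))"
  proof (intro sum.cong refl)
    fix d assume d: "d \<in> {1..K}"
    have "(\<Sum>k | k \<in> {1..K} \<and> d dvd k. f k * g d) = (\<Sum>k\<in>(*) d ` {1..K div d}. f k * g d)"
      using d by (subst multiples_upto[symmetric]) auto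
    also have "\<dots> = (\<Sum>m=1..K div d. f (d * m) * g d)"
      using d by (subst sum.reindex) (auto simp: inj_on_def)
    finally show "(\<Sum>k | k \<in> {1..K} \<and> d dvd k. f k * g d) = g d * (\<Sum>m=1..K div d. f (d * m))"
      by (simp add: sum_distrib_left mult.commute)
  qed
  finally show ?thesis .
qed

text \<open>The indicator of coprimality is the sum of \<open>moebius d\<close> over the divisors
  \<open>d\<close> of the gcd. After exchanging the sums, each \<open>d\<close> contributes the
  pairs of multiples of \<open>d\<close>.\<close>

lemma card_coprime_pairs:
  "real (card {(a, b). a \<in> {1..K} \<and> b \<in> {1..K} \<and> coprime a b})
     = (\<Sum>d=1..K. moebius d * (real (K div d))\<^sup>2)"
proof -
  let ?m = "\<lambda>d. {a \<in> {1..K}. d dvd a}"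
  have "real (card {(a, b). a \<in> {1..K} \<and> b \<in> {1..K} \<and> coprime a b})
      = (\<Sum>x\<in>{1..K} \<times> {1..K}. if coprime (fst x) (snd x) then 1 else 0)"
  proof -
    have "{(a, b). a \<in> {1..K} \<and> b \<in> {1..K} \<and> coprime a b} = {x \<in> {1..K} \<times> {1..K}. coprime (fst x) (snd x)}"
      by auto
    then show ?thesis
      by (simp only: card_eq_sum of_nat_sum of_nat_1) (rule sum.inter_filter, simp)
  qed
  also have "\<dots> = (\<Sum>x\<in>{1..K} \<times> {1..K}. \<Sum>d | d \<in> {1..K} \<and> d dvd fst x \<and> d dvd snd x. moebius d)"
  proof (intro sum.cong refl)
    fix x assume x: "x \<in> {1..K} \<times> {1..K}"
    then have "d \<in> {1..K}" if "d dvd fst x" for d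
      using that dvd_imp_le[OF that] dvd_pos_nat[OF _ that] by (cases x) force
    then have "{d. d \<in> {1..K} \<and> d dvd fst x \<and> d dvd snd x} = {d. d dvd gcd (fst x) (snd x)}"
      unfolding gcd_greatest_iff by blast
    moreover have "fst x \<noteq> 0" using x by (cases x) simp
    then have "gcd (fst x) (snd x) > 0" by (simp only: gcd_pos_nat) simp
    ultimately show "(if coprime (fst x) (snd x) then 1 else 0) = (\<Sum>d | d \<in> {1..K} \<and> d dvd fst x \<and> d dvd snd x. moebius d)"
      by (simp only: sum_moebius_divisors coprime_iff_gcd_eq_1)
  qed
  also have "\<dots> = (\<Sum>d=1..K. \<Sum>x | x \<in> {1..K} \<times> {1..K} \<and> d dvd fst x \<and> d dvd snd x. moebius d)"
    by (rule sum.swap_restrict) auto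
  also have "\<dots> = (\<Sum>d=1..K. moebius d * (real (K div d))\<^sup>2)"
  proof (intro sum.cong refl)
    fix d assume d: "d \<in> {1..K}"
    have "{x. x \<in> {1..K} \<times> {1..K} \<and> d dvd fst x \<and> d dvd snd x} = ?m d \<times> ?m d"
      by auto
    moreover have "card (?m d) = K div d"
      using d by (intro card_multiples_upto) auto
    ultimately show "(\<Sum>x | x \<in> {1..K} \<times> {1..K} \<and> d dvd fst x \<and> d dvd snd x. moebius d)
        = moebius d * (real (K div d))\<^sup>2"
      by (simp add: card_cartesian_product power2_eq_square)
  qed
  finally show ?thesis .
qed

text \<open>The partial sums increase to \<open>pi\<^sup>2 / 6\<close>, while by telescoping the
  partial sums plus \<open>1 / N\<close> decrease to the same limit.\<close>

lemma sum_inverse_squares_bounds: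
  assumes "M > 0"
  shows "0 \<le> pi\<^sup>2 / 6 - (\<Sum>m=1..M. 1 / (real m)\<^sup>2)"
    and "pi\<^sup>2 / 6 - (\<Sum>m=1..M. 1 / (real m)\<^sup>2) \<le> 1 / real M"
proof -
  have shift: "(\<Sum>m=1..N. 1 / (real m)\<^sup>2) = (\<Sum>n<N. 1 / (real n + 1)\<^sup>2)" for N
    by (rule sum.reindex_bij_witness[of _ Suc "\<lambda>m. m - 1"]) auto
  have lim: "(\<lambda>N. \<Sum>m=1..N. 1 / (real m)\<^sup>2) \<longlonglongrightarrow> pi\<^sup>2 / 6"
    using inverse_squares_sums unfolding shift sums_def by (simp add: add.commute)
  have "(\<Sum>m=1..M. 1 / (real m)\<^sup>2) \<le> pi\<^sup>2 / 6"
  proof (rule LIMSEQ_le_const[OF lim], intro exI allI impI)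
    fix N assume "M \<le> N"
    then show "(\<Sum>m=1..M. 1 / (real m)\<^sup>2) \<le> (\<Sum>m=1..N. 1 / (real m)\<^sup>2)"
      by (intro sum_mono2) auto
  qed
  then show "0 \<le> pi\<^sup>2 / 6 - (\<Sum>m=1..M. 1 / (real m)\<^sup>2)" by simp
  have tele: "(\<Sum>m=1..N. 1 / (real m)\<^sup>2) + 1 / real N \<le> (\<Sum>m=1..M. 1 / (real m)\<^sup>2) + 1 / real M"
    if "M \<le> N" for N
    using that
  proof (induction N rule: dec_induct)
    case (step N)
    have "1 / (real (Suc N))\<^sup>2 + 1 / real (Suc N) \<le> 1 / real N"
    proof -
      define x where "x = real N"
      have x: "x > 0" using step assms by (simp add: x_def)
      have "1 / (x + 1)\<^sup>2 \<le> 1 / (x * (x + 1))"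
        using x by (intro divide_left_mono) (auto simp: power2_eq_square)
      also have "\<dots> = 1 / x - 1 / (x + 1)"
        using x by (simp add: divide_simps)
      finally show ?thesis by (simp add: x_def add.commute)
    qed
    then show ?case using step by simp
  qed simp
  have "pi\<^sup>2 / 6 \<le> (\<Sum>m=1..M. 1 / (real m)\<^sup>2) + 1 / real M"
  proof (rule LIMSEQ_le_const2[OF lim], intro exI allI impI)
    fix N assume "M \<le> N"
    have "0 \<le> 1 / real N" by simp
    with tele[OF \<open>M \<le> N\<close>] show "(\<Sum>m=1..N. 1 / (real m)\<^sup>2) \<le> (\<Sum>m=1..M. 1 / (real m)\<^sup>2) + 1 / real M"
      by linarith
  qed
  then show "pi\<^sup>2 / 6 - (\<Sum>m=1..M. 1 / (real m)\<^sup>2) \<le> 1 / real M" by simp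
qed

text \<open>The sum of \<open>moebius d / (d * m)\<^sup>2\<close> over all
  \<open>d * m \<le> K\<close> is exactly 1, since only \<open>k = 1\<close> survives. Completing
  each inner sum over \<open>m\<close> to \<open>pi\<^sup>2 / 6\<close> costs at most
  \<open>1 / (K div d)\<close>. Working with finite sums in this way makes the value of the infinite
  Moebius series unnecessary.\<close>

lemma sum_moebius_over_squares:
  assumes "K > 0"
  shows "\<bar>pi\<^sup>2 / 6 * (\<Sum>d=1..K. moebius d / (real d)\<^sup>2) - 1\<bar> \<le> 2 * harm K / real K"
proof -
  define T where "T M = (\<Sum>m=1..M. 1 / (real m)\<^sup>2)" for M
  have "(\<Sum>d=1..K. moebius d * (\<Sum>m=1..K div d. 1 / (real (d * m))\<^sup>2))
      = (\<Sum>k=1..K. 1 / (real k)\<^sup>2 * (\<Sum>d | d dvd k. moebius d))"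
    by (rule sum_divisors_swap[symmetric])
  also have "\<dots> = (\<Sum>k=1..K. if k = 1 then 1 else 0)"
    by (intro sum.cong refl) (auto simp: sum_moebius_divisors)
  also have "\<dots> = 1"
    using assms by simp
  finally have one: "(\<Sum>d=1..K. moebius d / (real d)\<^sup>2 * T (K div d)) = 1"
    by (simp add: T_def sum_distrib_left power_mult_distrib)
  have "pi\<^sup>2 / 6 * (\<Sum>d=1..K. moebius d / (real d)\<^sup>2) - 1
      = (\<Sum>d=1..K. moebius d / (real d)\<^sup>2 * (pi\<^sup>2 / 6 - T (K div d)))"
    unfolding one[symmetric] by (simp add: right_diff_distrib sum_subtractf sum_distrib_left mult_ac)
  also have "\<bar>\<dots>\<bar> \<le> (\<Sum>d=1..K. 2 / real K * inverse (real d))"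
  proof (rule sum_abs[THEN order_trans], rule sum_mono)
    fix d assume d: "d \<in> {1..K}"
    define M where "M = K div d"
    have M: "M > 0" using d by (auto simp: M_def div_greater_zero_iff)
    \<comment> \<open>Since \<open>M \<ge> 1\<close>, rounding down loses at most a factor 2, which
      is the 2 in the final bound.\<close>
    have "K < d * (M + 1)"
      using d unfolding M_def by (simp add: dividend_less_times_div)
    also have "\<dots> \<le> 2 * d * M" using M by (simp add: algebra_simps)
    finally have "real K \<le> real (2 * d * M)"
      by (simp only: of_nat_le_iff less_imp_le)
    then have "real K \<le> 2 * real d * real M"
      by simp
    then have "1 / real M \<le> 2 * real d / real K"
      using M assms by (simp add: field_simps)
    then have t: "\<bar>pi\<^sup>2 / 6 - T M\<bar> \<le> 2 * real d / real K"
      using sum_inverse_squares_bounds[OF M] unfolding T_def by linarith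
    have "\<bar>moebius d / (real d)\<^sup>2 * (pi\<^sup>2 / 6 - T M)\<bar> = \<bar>moebius d\<bar> * (\<bar>pi\<^sup>2 / 6 - T M\<bar> / (real d)\<^sup>2)"
      by (simp add: abs_mult)
    also have "\<dots> \<le> 1 * ((2 * real d / real K) / (real d)\<^sup>2)"
      using t by (intro mult_mono divide_right_mono abs_moebius_le_1) auto
    also have "\<dots> = 2 / real K * inverse (real d)"
      using d by (simp add: power2_eq_square field_simps)
    finally show "\<bar>moebius d / (real d)\<^sup>2 * (pi\<^sup>2 / 6 - T (K div d))\<bar> \<le> 2 / real K * inverse (real d)"
      by (simp add: M_def)
  qed
  also have "\<dots> = 2 * harm K / real K"
    by (simp add: harm_def sum_distrib_left sum_divide_distrib)
  finally show ?thesis .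
qed

text \<open>The constant 4 is 2 + 2: one share from replacing the truncated sum \<open>S\<close> by
  \<open>6 / pi\<^sup>2\<close>, the other from replacing \<open>K div d\<close> by
  \<open>K / d\<close> in the exact formula.\<close>

lemma card_coprime_pairs_asymp:
  assumes "K > 0"
  shows "\<bar>real (card {(a, b). a \<in> {1..K} \<and> b \<in> {1..K} \<and> coprime a b}) - 6 / pi\<^sup>2 * (real K)\<^sup>2\<bar>
    \<le> 4 * (real K * harm K)"
proof -
  define S where "S = (\<Sum>d=1..K. moebius d / (real d)\<^sup>2)"
  have pi2: "pi\<^sup>2 \<ge> 6"
    using pi_gt3 power_mono[of 3 pi 2] by simp
  have "\<bar>6 / pi\<^sup>2 * (pi\<^sup>2 / 6 * S - 1)\<bar> = 6 / pi\<^sup>2 * \<bar>pi\<^sup>2 / 6 * S - 1\<bar>"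
    by (subst abs_mult) (simp only: abs_divide abs_power2 abs_numeral)
  also have "\<dots> \<le> 1 * \<bar>pi\<^sup>2 / 6 * S - 1\<bar>"
    using pi2 by (intro mult_right_mono) (auto simp: field_simps)
  also have "\<dots> \<le> 2 * harm K / real K"
    using sum_moebius_over_squares[OF assms] by (simp add: S_def)
  also have "6 / pi\<^sup>2 * (pi\<^sup>2 / 6 * S - 1) = S - 6 / pi\<^sup>2"
    by (simp add: field_simps)
  finally have "\<bar>S - 6 / pi\<^sup>2\<bar> \<le> 2 * harm K / real K" .
  then have "(real K)\<^sup>2 * \<bar>S - 6 / pi\<^sup>2\<bar> \<le> (real K)\<^sup>2 * (2 * harm K / real K)"
    by (intro mult_left_mono) auto
  moreover have "(real K)\<^sup>2 * \<bar>S - 6 / pi\<^sup>2\<bar> = \<bar>(real K)\<^sup>2 * S - 6 / pi\<^sup>2 * (real K)\<^sup>2\<bar>"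
  proof -
    have "(real K)\<^sup>2 * S - 6 / pi\<^sup>2 * (real K)\<^sup>2 = (real K)\<^sup>2 * (S - 6 / pi\<^sup>2)"
      by (simp add: right_diff_distrib)
    then show ?thesis by (simp only: abs_mult abs_power2)
  qed
  moreover have "(real K)\<^sup>2 * (2 * harm K / real K) = 2 * (real K * harm K)"
    using assms by (simp add: power2_eq_square)
  ultimately have main: "\<bar>(real K)\<^sup>2 * S - 6 / pi\<^sup>2 * (real K)\<^sup>2\<bar> \<le> 2 * (real K * harm K)"
    by linarith
  have "(\<Sum>d=1..K. moebius d * (real (K div d))\<^sup>2) - (real K)\<^sup>2 * S
      = (\<Sum>d=1..K. moebius d * ((real (K div d))\<^sup>2 - (real K / real d)\<^sup>2))"
    by (simp add: S_def right_diff_distrib sum_subtractf sum_distrib_left power_divide mult_ac)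
  also have "\<bar>\<dots>\<bar> \<le> (\<Sum>d=1..K. 2 * real K * inverse (real d))"
  proof (rule sum_abs[THEN order_trans], rule sum_mono)
    fix d assume d: "d \<in> {1..K}"
    define x where "x = real K / real d"
    define y where "y = real (K div d)"
    have y: "0 \<le> y" "y \<le> x" by (simp_all add: x_def y_def of_nat_div_le_of_nat)
    have "K < d * (K div d + 1)"
      using d by (simp add: dividend_less_times_div)
    then have "real K < real (d * (K div d + 1))"
      by (simp only: of_nat_less_iff)
    then have "real K < real d * (y + 1)"
      by (simp add: y_def algebra_simps)
    then have "x - 1 \<le> y"
      using d by (simp add: x_def field_simps)
    \<comment> \<open>The difference of squares is factored: rounding changes \<open>x\<close> by at
      most 1, and \<open>x + y \<le> 2 * x\<close>.\<close>
    then have "(x - y) * (x + y) \<le> 1 * (2 * x)"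
      using y by (intro mult_mono) auto
    moreover have "0 \<le> (x - y) * (x + y)" using y by simp
    ultimately have "\<bar>y\<^sup>2 - x\<^sup>2\<bar> \<le> 2 * x"
      by (simp add: power2_eq_square algebra_simps abs_if)
    then have "\<bar>moebius d\<bar> * \<bar>y\<^sup>2 - x\<^sup>2\<bar> \<le> 1 * (2 * x)"
      by (intro mult_mono abs_moebius_le_1) auto
    then show "\<bar>moebius d * ((real (K div d))\<^sup>2 - (real K / real d)\<^sup>2)\<bar> \<le> 2 * real K * inverse (real d)"
      by (simp add: x_def y_def abs_mult divide_inverse)
  qed
  also have "\<dots> = 2 * (real K * harm K)"
    by (simp add: harm_def sum_distrib_left mult_ac)
  finally show ?thesis
    using main unfolding card_coprime_pairs by linarith
qed

section \<open>Thue's lemma and the exact count of solutions of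
  \<open>a * d + b * c = n\<close>\<close>

definition coprime_pairs :: "int \<Rightarrow> (int \<times> int) set" where
  "coprime_pairs K = {(a, b). a \<in> {1..K} \<and> b \<in> {1..K} \<and> coprime a b}"

text \<open>The left side of the equation is the determinant of the matrix with rows
  \<open>a, b\<close> and \<open>- c, d\<close>; the reversed sign of \<open>c\<close> keeps all
  four unknowns positive.\<close>

definition det_solutions :: "int \<Rightarrow> int \<Rightarrow> (int \<times> int \<times> int \<times> int) set" where
  "det_solutions n K = {(a, b, c, d). {a, b, c, d} \<subseteq> {1..K} \<and> a * d + b * c = n}"

lemma finite_coprime_pairs: "finite (coprime_pairs K)"
  by (rule finite_subset[of _ "{1..K} \<times> {1..K}"]) (auto simp: coprime_pairs_def)

text \<open>Two distinct points of the grid share the residue of \<open>x * u - y\<close>, and their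
  difference is the required pair. Separate bounds \<open>A\<close> and \<open>B\<close> are allowed
  because the modulus \<open>p\<^sup>2\<close> calls for a box that is not square.\<close>

lemma thue_pigeonhole:
  fixes n A B u :: int
  assumes "n > 0" "A \<ge> 0" "B \<ge> 0" "(A + 1) * (B + 1) > n"
  obtains x y where "(x, y) \<noteq> (0, 0)" "\<bar>x\<bar> \<le> A" "\<bar>y\<bar> \<le> B" "[x * u = y] (mod n)"
proof -
  let ?S = "{0..A} \<times> {0..B}"
  let ?f = "\<lambda>(x, y). (x * u - y) mod n"
  have "card (?f ` ?S) \<le> card {0..<n}"
    using assms by (intro card_mono) auto
  also have "\<dots> = nat n" by simp
  also have "\<dots> < nat ((A + 1) * (B + 1))"
    using assms by linarith
  also have "\<dots> = card ?S"
    using assms by (simp add: card_cartesian_product nat_mult_distrib)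
  finally have "\<not> inj_on ?f ?S" by (rule pigeonhole)
  then obtain x y x' y' where h: "(x, y) \<in> ?S" "(x', y') \<in> ?S" "(x, y) \<noteq> (x', y')"
    "(x * u - y) mod n = (x' * u - y') mod n"
    unfolding inj_on_def by auto
  have "[(x - x') * u = y - y'] (mod n)"
  proof -
    have "n dvd (x * u - y) - (x' * u - y')"
      using h(4) by (simp add: mod_eq_dvd_iff)
    also have "(x * u - y) - (x' * u - y') = (x - x') * u - (y - y')"
      by (simp add: algebra_simps)
    finally show ?thesis by (simp add: cong_iff_dvd_diff)
  qed
  then show thesis
    using h by (intro that[of "x - x'" "y - y'"]) auto
qed

text \<open>The conclusion of Thue's lemma is a hypothesis here: for a prime modulus the pigeonhole
  principle gives it at once, for \<open>p\<^sup>2\<close> a further argument is needed. With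
  \<open>A\<close> the set of units \<open>b / a\<close> and \<open>B\<close> the set of their
  negatives, the claim is inclusion-exclusion for \<open>A \<union> B = U\<close>, where
  \<open>A \<inter> B\<close> is in bijection with the solutions.\<close>

lemma card_det_solutions:
  fixes n K :: int
  assumes n: "n > 1" and K: "K\<^sup>2 < n"
    and cop: "\<And>a. a \<in> {1..K} \<Longrightarrow> coprime a n"
    and thue: "\<And>u. coprime u n \<Longrightarrow>
      \<exists>x y. (x, y) \<noteq> (0, 0) \<and> \<bar>x\<bar> \<le> K \<and> \<bar>y\<bar> \<le> K \<and> [x * u = y] (mod n)"
  shows "card (det_solutions n K) + totient (nat n) = 2 * card (coprime_pairs K)"
proof -
  define U where "U = {u::int. 0 < u \<and> u < n \<and> coprime u n}"
  let ?Q = "coprime_pairs K"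
  have prod_lt: "a * b < n" "0 < a * b" if "a \<in> {1..K}" "b \<in> {1..K}" for a b
  proof -
    have "a * b \<le> K * K" using that by (intro mult_mono) auto
    then show "a * b < n" using K by (simp add: power2_eq_square)
    show "0 < a * b" using that by simp
  qed
  have Kn: "K < n" if "K \<ge> 1"
    using prod_lt(1)[of K 1] that by simp
  have only_n: "x = n" if "n dvd x" "0 < x" "x < 2 * n" for x
  proof -
    obtain k where k: "x = n * k" using \<open>n dvd x\<close> by (elim dvdE)
    have "0 < k" using that(2) n k by (simp add: zero_less_mult_iff)
    moreover have "k < 2" using that(3) n unfolding k by (simp add: mult.commute)
    ultimately show ?thesis using k by simp
  qed
  have finU: "finite U"
    by (rule finite_subset[of _ "{0..n}"]) (auto simp: U_def)
  have cardU: "card U = totient (nat n)"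
  proof -
    \<comment> \<open>\<open>totatives\<close> also admits \<open>n\<close> itself, but
      \<open>n > 1\<close> is not coprime to itself.\<close>
    have "U = int ` totatives (nat n)"
    proof (intro equalityI subsetI)
      fix u assume u: "u \<in> U"
      obtain k m where km: "u = int k" "n = int m"
        using u n zero_le_imp_eq_int[of u] zero_le_imp_eq_int[of n] by (auto simp: U_def)
      then have "k \<in> totatives (nat n)"
        using u by (simp add: U_def totatives_def)
      then show "u \<in> int ` totatives (nat n)" using km by blast
    next
      fix u assume "u \<in> int ` totatives (nat n)"
      then obtain k where k: "u = int k" "0 < k" "k \<le> nat n" "coprime k (nat n)"
        by (auto simp: totatives_def)
      obtain m where m: "n = int m"
        using n zero_le_imp_eq_int[of n] by auto
      have "k \<noteq> m" using k n m by auto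
      then show "u \<in> U" using k m by (simp add: U_def)
    qed
    then show ?thesis
      by (simp add: card_image totient_def)
  qed
  have "\<exists>u\<in>U. [fst q * u = snd q] (mod n)" if "q \<in> ?Q" for q
  proof -
    obtain a b where q: "q = (a, b)" by (cases q)
    then have ab: "a \<in> {1..K}" "b \<in> {1..K}"
      using that by (auto simp: coprime_pairs_def)
    obtain v where v: "[a * v = 1] (mod n)"
      using cop[OF ab(1)] cong_solve_coprime_int by blast
    define u where "u = (v * b) mod n"
    have "[a * u = a * (v * b)] (mod n)"
      unfolding u_def by (intro cong_mult) auto
    also have "[a * (v * b) = b] (mod n)"
      using cong_mult[OF v cong_refl[of b]] by (simp add: mult_ac)
    finally have au: "[a * u = b] (mod n)" .
    have "coprime (a * u) n"
      using cop[OF ab(2)] au cong_imp_coprime cong_sym by blast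
    then have "coprime u n" by simp
    moreover have "u \<noteq> 0"
      using \<open>coprime u n\<close> n by auto
    moreover have "0 \<le> u" "u < n" using n by (simp_all add: u_def)
    ultimately show ?thesis using au q by (intro bexI[of _ u]) (auto simp: U_def)
  qed
  \<comment> \<open>\<open>tau (a, b)\<close> is the residue \<open>b / a\<close>.\<close>
  then obtain tau where tau: "\<And>q. q \<in> ?Q \<Longrightarrow> tau q \<in> U"
      "\<And>q. q \<in> ?Q \<Longrightarrow> [fst q * tau q = snd q] (mod n)"
    by metis
  \<comment> \<open>Cross-multiplying, \<open>a * d\<close> and \<open>c * b\<close> are congruent
    and both lie strictly between 0 and \<open>n\<close>, so they are equal; a fraction in lowest
    terms has only one numerator and denominator.\<close>
  have unique: "a = c \<and> b = d"
    if "(a, b) \<in> ?Q" "(c, d) \<in> ?Q" "[a * u = b] (mod n)" "[c * u = d] (mod n)" for a b c d u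
  proof -
    have r: "a \<in> {1..K}" "b \<in> {1..K}" "c \<in> {1..K}" "d \<in> {1..K}" "coprime a b" "coprime c d"
      using that by (auto simp: coprime_pairs_def)
    have "[a * d = a * (c * u)] (mod n)"
      using that(4) by (intro cong_mult) (auto simp: cong_sym)
    also have "a * (c * u) = c * (a * u)" by simp
    also have "[c * (a * u) = c * b] (mod n)"
      using that(3) by (intro cong_mult) auto
    finally have "n dvd a * d - c * b"
      by (simp add: cong_iff_dvd_diff)
    moreover have "\<bar>a * d - c * b\<bar> < n"
      using prod_lt[OF r(1,4)] prod_lt[OF r(3,2)] by linarith
    ultimately have "a * d = c * b"
      using n zdvd_not_zless[of "\<bar>a * d - c * b\<bar>" n] by (auto simp: dvd_abs_iff)
    then have eq: "a * d = c * b" .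
    then have "a dvd c * b" "c dvd a * d" by (metis dvd_triv_left)+
    then have "a dvd c" "c dvd a"
      using r by (auto simp: coprime_dvd_mult_left_iff)
    then have "a = c" using r by (auto intro: zdvd_antisym_nonneg)
    then show ?thesis using eq r by auto
  qed
  have inj: "inj_on tau ?Q"
  proof (rule inj_onI)
    fix q q' assume h: "q \<in> ?Q" "q' \<in> ?Q" "tau q = tau q'"
    have "(fst q, snd q) \<in> ?Q" "(fst q', snd q') \<in> ?Q" using h by simp_all
    from unique[OF this tau(2)[OF h(1)]] tau(2)[OF h(2)] h(3)
    show "q = q'" by (simp add: prod_eq_iff)
  qed
  define A where "A = tau ` ?Q"
  define B where "B = (\<lambda>q. n - tau q) ` ?Q"
  have injB: "inj_on (\<lambda>q. n - tau q) ?Q"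
    using inj by (auto simp: inj_on_def)
  have fin: "finite A" "finite B"
    by (simp_all add: A_def B_def finite_coprime_pairs)
  have cAB: "card A = card ?Q" "card B = card ?Q"
    by (simp_all add: A_def B_def card_image inj injB)
  have Uneg: "n - u \<in> U" if "u \<in> U" for u
  proof -
    have "coprime (n - u) n"
    proof (rule coprimeI)
      fix e assume e: "e dvd n - u" "e dvd n"
      then have "e dvd u" using dvd_diff[OF e(2,1)] by simp
      with e(2) that show "is_unit e" by (auto simp: U_def dest: coprime_common_divisor)
    qed
    then show ?thesis using that by (simp add: U_def)
  qed
  have AB: "A \<union> B = U"
  proof (intro equalityI subsetI)
    fix u assume "u \<in> A \<union> B"
    then show "u \<in> U" using tau(1) Uneg by (auto simp: A_def B_def)
  next
    fix u assume u: "u \<in> U"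
    then have "coprime u n" by (simp add: U_def)
    from thue[OF this]
    obtain x y where xy: "(x, y) \<noteq> (0, 0)" "\<bar>x\<bar> \<le> K" "\<bar>y\<bar> \<le> K" "[x * u = y] (mod n)"
      by blast
    have small: "z = 0" if "\<bar>z\<bar> \<le> K" "n dvd z" for z
    proof (rule ccontr)
      assume "z \<noteq> 0"
      then have "n \<le> \<bar>z\<bar>" using dvd_imp_le_int[of z n] that(2) n by simp
      then show False using that(1) Kn n by linarith
    qed
    have "x \<noteq> 0"
    proof
      assume "x = 0"
      then have "n dvd y" using xy(4) by (simp add: cong_iff_dvd_diff)
      then show False using small xy \<open>x = 0\<close> by auto
    qed
    moreover have "y \<noteq> 0"
    proof
      assume "y = 0"
      then have "n dvd x * u" using xy(4) by (simp add: cong_iff_dvd_diff)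
      then have "n dvd x"
        using u by (simp add: U_def coprime_commute coprime_dvd_mult_left_iff)
      then show False using small xy \<open>y = 0\<close> by auto
    qed
    ultimately have nz: "x \<noteq> 0" "y \<noteq> 0" by auto
    \<comment> \<open>Thue's pair need not be coprime. As
      \<open>g \<le> \<bar>x\<bar> \<le> K\<close>, the gcd is coprime to \<open>n\<close> and can
      be cancelled from the congruence.\<close>
    define g where "g = gcd x y"
    obtain x1 y1 where x1: "x = g * x1" "y = g * y1" "coprime x1 y1"
      using nz gcd_coprime_exists[of x y] unfolding g_def by (metis gcd_eq_0_iff mult.commute)
    have g: "g > 0" using nz by (simp add: g_def)
    have x1nz: "x1 \<noteq> 0" "y1 \<noteq> 0" using nz x1 by auto
    have bounds: "\<bar>x1\<bar> \<le> \<bar>x\<bar>" "\<bar>y1\<bar> \<le> \<bar>y\<bar>" "g \<le> \<bar>x\<bar>"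
    proof -
      have "x1 dvd x" "y1 dvd y" "g dvd x" using x1 by auto
      then show "\<bar>x1\<bar> \<le> \<bar>x\<bar>" "\<bar>y1\<bar> \<le> \<bar>y\<bar>" "g \<le> \<bar>x\<bar>"
        using nz g dvd_imp_le_int[of x x1] dvd_imp_le_int[of y y1] dvd_imp_le_int[of x g] by auto
    qed
    have "coprime g n" using cop g bounds xy by auto
    moreover have "[g * (x1 * u) = g * y1] (mod n)"
      using xy(4) x1 by (simp add: mult_ac)
    ultimately have c: "[x1 * u = y1] (mod n)"
      using cong_mult_lcancel by blast
    define a where "a = \<bar>x1\<bar>"
    define b where "b = \<bar>y1\<bar>"
    have q: "(a, b) \<in> ?Q"
      using x1nz bounds xy x1(3) by (auto simp: a_def b_def coprime_pairs_def)
    have tq: "tau (a, b) \<in> U" "[a * tau (a, b) = b] (mod n)"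
      using tau[OF q] by auto
    have "coprime a n" using q cop by (auto simp: coprime_pairs_def)
    have Ueq: "v = w" if "v \<in> U" "w \<in> U" "[v = w] (mod n)" for v w
      using that by (auto simp: U_def intro: cong_less_imp_eq_int)
    \<comment> \<open>Passing to absolute values loses only the relative sign of \<open>x1\<close>
      and \<open>y1\<close>, which decides between \<open>A\<close> and \<open>B\<close>.\<close>
    have "[a * u = b] (mod n) \<or> [a * u = - b] (mod n)"
    proof -
      have "n dvd x1 * u - y1" using c by (simp add: cong_iff_dvd_diff)
      moreover have "n dvd - (x1 * u - y1)" using calculation by (simp only: dvd_minus_iff)
      ultimately show ?thesis
        unfolding cong_iff_dvd_diff a_def b_def
        by (cases "x1 \<ge> 0"; cases "y1 \<ge> 0") (auto simp: algebra_simps)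
    qed
    then show "u \<in> A \<union> B"
    proof
      assume "[a * u = b] (mod n)"
      then have "[a * u = a * tau (a, b)] (mod n)"
        using tq(2) cong_sym cong_trans by blast
      then have "[u = tau (a, b)] (mod n)"
        using \<open>coprime a n\<close> cong_mult_lcancel by blast
      then have "u = tau (a, b)" using Ueq u tq(1) by blast
      then show ?thesis using q by (auto simp: A_def)
    next
      assume "[a * u = - b] (mod n)"
      then have f1: "n dvd a * u + b" by (simp add: cong_iff_dvd_diff)
      have f2: "n dvd a * tau (a, b) - b" using tq(2) by (simp add: cong_iff_dvd_diff)
      have "n dvd a * n - ((a * u + b) + (a * tau (a, b) - b))"
        by (rule dvd_diff[OF dvd_triv_right dvd_add[OF f1 f2]])
      then have "[a * (n - tau (a, b)) = a * u] (mod n)"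
        by (simp add: cong_iff_dvd_diff algebra_simps)
      then have "[n - tau (a, b) = u] (mod n)"
        using \<open>coprime a n\<close> cong_mult_lcancel by blast
      then have "u = n - tau (a, b)" using Ueq[OF Uneg[OF tq(1)] u] by simp
      then show ?thesis using q by (auto simp: B_def)
    qed
  qed
  have W: "card (det_solutions n K) = card (A \<inter> B)"
  proof (rule bij_betw_same_card[where f = "\<lambda>(a, b, c, d). tau (a, b)"], rule bij_betw_imageI)
    have W_Q: "(a, b) \<in> ?Q" "(c, d) \<in> ?Q" "tau (a, b) = n - tau (c, d)"
      if "(a, b, c, d) \<in> det_solutions n K" for a b c d
    proof -
      have r: "a \<in> {1..K}" "b \<in> {1..K}" "c \<in> {1..K}" "d \<in> {1..K}" "a * d + b * c = n"
        using that by (auto simp: det_solutions_def)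
      have cp: "coprime x y" if "x \<in> {1..K}" "x * z + y * w = n" for x y z w
      proof (rule coprimeI)
        fix e assume e: "e dvd x" "e dvd y"
        then have "e dvd n" using that(2) by (metis dvd_add dvd_mult2)
        with e cop[OF that(1)] show "is_unit e" by (meson coprime_common_divisor)
      qed
      show q1: "(a, b) \<in> ?Q" using r cp[of a d b c] by (auto simp: coprime_pairs_def)
      have "d * a + c * b = n" using r by (simp add: mult_ac)
      then have "coprime d c" using r(4) cp by blast
      then show q2: "(c, d) \<in> ?Q" using r by (auto simp: coprime_pairs_def coprime_commute)
      have f: "n dvd a * tau (a, b) - b" "n dvd c * tau (c, d) - d"
        using tau(2)[OF q1] tau(2)[OF q2] by (simp_all add: cong_iff_dvd_diff)
      \<comment> \<open>This is \<open>b / a + d / c = (a * d + b * c) / (a * c)\<close> with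
        denominators cleared; as \<open>a * c\<close> is a unit, the sum of the two residues is
        divisible by \<open>n\<close>.\<close>
      have "n dvd c * (a * tau (a, b) - b) + a * (c * tau (c, d) - d) + (a * d + b * c)"
        unfolding r(5) by (rule dvd_add[OF dvd_add[OF dvd_mult[OF f(1)] dvd_mult[OF f(2)]] dvd_refl])
      also have "\<dots> = a * c * (tau (a, b) + tau (c, d))"
        by (simp add: algebra_simps)
      finally have "n dvd tau (a, b) + tau (c, d)"
        using cop[OF r(1)] cop[OF r(3)] by (simp add: coprime_dvd_mult_right_iff coprime_commute)
      moreover have "0 < tau (a, b) + tau (c, d)" "tau (a, b) + tau (c, d) < 2 * n"
        using tau(1)[OF q1] tau(1)[OF q2] by (auto simp: U_def)
      ultimately have "tau (a, b) + tau (c, d) = n"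
        by (rule only_n)
      then show "tau (a, b) = n - tau (c, d)" by simp
    qed
    show "inj_on (\<lambda>(a, b, c, d). tau (a, b)) (det_solutions n K)"
    proof (rule inj_onI)
      fix w w'
      assume w: "w \<in> det_solutions n K" "w' \<in> det_solutions n K"
        "(\<lambda>(a, b, c, d). tau (a, b)) w = (\<lambda>(a, b, c, d). tau (a, b)) w'"
      obtain a b c d a' b' c' d' where e: "w = (a, b, c, d)" "w' = (a', b', c', d')"
        by (metis prod_cases4)
      have h: "(a, b, c, d) \<in> det_solutions n K" "(a', b', c', d') \<in> det_solutions n K"
        "tau (a, b) = tau (a', b')"
        using w e by simp_all
      have "tau (c, d) = tau (c', d')"
        using W_Q(3)[OF h(1)] W_Q(3)[OF h(2)] h(3) by simp
      with inj_onD[OF inj h(3) W_Q(1)[OF h(1)] W_Q(1)[OF h(2)]]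
        inj_onD[OF inj _ W_Q(2)[OF h(1)] W_Q(2)[OF h(2)]]
      show "w = w'"
        using e by simp
    qed
    show "(\<lambda>(a, b, c, d). tau (a, b)) ` det_solutions n K = A \<inter> B"
    proof (intro equalityI subsetI)
      fix u assume "u \<in> (\<lambda>(a, b, c, d). tau (a, b)) ` det_solutions n K"
      then obtain a b c d where abcd: "(a, b, c, d) \<in> det_solutions n K" "u = tau (a, b)" by auto
      have "u \<in> A"
        unfolding A_def by (rule image_eqI[where f = tau, OF abcd(2) W_Q(1)[OF abcd(1)]])
      moreover have "u \<in> B"
        unfolding B_def using abcd(2) W_Q(3)[OF abcd(1)] by (intro image_eqI[OF _ W_Q(2)[OF abcd(1)]]) simp
      ultimately show "u \<in> A \<inter> B" ..
    next
      fix u assume "u \<in> A \<inter> B"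
      then obtain q q' where "q \<in> ?Q" "q' \<in> ?Q" "u = tau q" "u = n - tau q'"
        unfolding A_def B_def by blast
      then obtain a b c d where h: "(a, b) \<in> ?Q" "(c, d) \<in> ?Q" "u = tau (a, b)" "u = n - tau (c, d)"
        by (metis surj_pair)
      have r: "a \<in> {1..K}" "b \<in> {1..K}" "c \<in> {1..K}" "d \<in> {1..K}"
        using h by (auto simp: coprime_pairs_def)
      have td: "tau (c, d) = n - tau (a, b)" using h by simp
      have f: "n dvd a * tau (a, b) - b" "n dvd c * tau (c, d) - d"
        using tau(2)[OF h(1)] tau(2)[OF h(2)] by (simp_all add: cong_iff_dvd_diff)
      \<comment> \<open>The same identity read backwards: the residues add up to \<open>n\<close>,
        so \<open>n\<close> divides \<open>a * d + b * c\<close>, which is too small to be any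
        multiple other than \<open>n\<close>.\<close>
      have "n dvd n * (a * c) - (c * (a * tau (a, b) - b) + a * (c * tau (c, d) - d))"
        by (rule dvd_diff[OF dvd_triv_left dvd_add[OF dvd_mult[OF f(1)] dvd_mult[OF f(2)]]])
      also have "\<dots> = a * d + b * c"
        unfolding td by (simp add: algebra_simps)
      finally have "n dvd a * d + b * c" .
      moreover have "0 < a * d + b * c" "a * d + b * c < 2 * n"
        using prod_lt[OF r(1,4)] prod_lt[OF r(2,3)] by linarith+
      ultimately have "a * d + b * c = n"
        by (rule only_n)
      then have "(a, b, c, d) \<in> det_solutions n K"
        using r by (auto simp: det_solutions_def)
      then show "u \<in> (\<lambda>(a, b, c, d). tau (a, b)) ` det_solutions n K"
        using h(3) by force
    qed
  qed
  have "card A + card B = card (A \<union> B) + card (A \<inter> B)"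
    using fin by (rule card_Un_Int)
  then show ?thesis
    using W AB cAB cardU by simp
qed

lemma card_coprime_pairs_int:
  "card (coprime_pairs (int k)) = card {(a, b). a \<in> {1..k} \<and> b \<in> {1..k} \<and> coprime a b}"
proof -
  let ?S = "{(a, b). a \<in> {1..k} \<and> b \<in> {1..k} \<and> coprime a b}"
  have "coprime_pairs (int k) = map_prod int int ` ?S"
  proof (intro equalityI subsetI)
    fix q assume "q \<in> coprime_pairs (int k)"
    then obtain a b where q: "q = (a, b)" "1 \<le> a" "a \<le> int k" "1 \<le> b" "b \<le> int k" "coprime a b"
      by (auto simp: coprime_pairs_def)
    then obtain x y where xy: "a = int x" "b = int y"
      using zero_le_imp_eq_int[of a] zero_le_imp_eq_int[of b] by auto
    then have "(x, y) \<in> ?S" using q by simp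
    moreover have "q = map_prod int int (x, y)" using q xy by simp
    ultimately show "q \<in> map_prod int int ` ?S" by (rule rev_image_eqI)
  next
    fix q assume "q \<in> map_prod int int ` ?S"
    then show "q \<in> coprime_pairs (int k)"
      by (auto simp: coprime_pairs_def)
  qed
  moreover have "inj_on (map_prod int int) ?S"
    by (auto simp: inj_on_def)
  ultimately show ?thesis by (simp add: card_image)
qed

section \<open>From matrices to positive solutions\<close>

definition box_dets :: "int \<Rightarrow> int \<Rightarrow> (int \<times> int \<times> int \<times> int) set" where
  "box_dets n K = {(a, b, c, d). \<bar>a\<bar> \<le> K \<and> \<bar>b\<bar> \<le> K \<and> \<bar>c\<bar> \<le> K \<and> \<bar>d\<bar> \<le> K \<and> a * d - b * c = n}"

lemma finite_box_dets: "finite (box_dets n K)"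
  by (rule finite_subset[of _ "{-K..K} \<times> {-K..K} \<times> {-K..K} \<times> {-K..K}"]) (auto simp: box_dets_def)

lemma matrix_count_eq_card_box_dets:
  "matrix_count n X = card (box_dets (int n) \<lfloor>X\<rfloor>)"
proof -
  let ?f = "\<lambda>A :: int ^ 2 ^ 2. (A $ 1 $ 1, A $ 1 $ 2, A $ 2 $ 1, A $ 2 $ 2)"
  let ?g = "\<lambda>(a, b, c, d). vector [vector [a, b], vector [c, d]] :: int ^ 2 ^ 2"
  have le: "real_of_int x \<le> X \<longleftrightarrow> x \<le> \<lfloor>X\<rfloor>" for x
    by (simp add: le_floor_iff)
  show ?thesis unfolding matrix_count_def
  proof (rule bij_betw_same_card[where f = ?f], rule bij_betw_byWitness[where f' = ?g])
    show "\<forall>A\<in>{A. det A = int n \<and> (\<forall>i j. real_of_int \<bar>A $ i $ j\<bar> \<le> X)}. ?g (?f A) = A"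
      by (simp add: vec_eq_iff forall_2)
    show "\<forall>q\<in>box_dets (int n) \<lfloor>X\<rfloor>. ?f (?g q) = q"
      by auto
    show "?f ` {A. det A = int n \<and> (\<forall>i j. real_of_int \<bar>A $ i $ j\<bar> \<le> X)} \<subseteq> box_dets (int n) \<lfloor>X\<rfloor>"
      unfolding le by (auto simp: box_dets_def det_2 forall_2)
    show "?g ` box_dets (int n) \<lfloor>X\<rfloor> \<subseteq> {A. det A = int n \<and> (\<forall>i j. real_of_int \<bar>A $ i $ j\<bar> \<le> X)}"
      unfolding le by (auto simp: box_dets_def det_2 forall_2)
  qed
qed

text \<open>When all products of two entries are smaller than the determinant \<open>a d - b c\<close>, both \<open>a d\<close> and
  \<open>- b c\<close> are positive, so the signs of \<open>a\<close> and \<open>b\<close> determine those of \<open>d\<close> and \<open>c\<close>.\<close>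

lemma card_box_dets:
  assumes K: "K\<^sup>2 < n"
  shows "card (box_dets n K) = 4 * card (det_solutions n K)"
proof -
  let ?f = "\<lambda>((s, t), (a, b, c, d)). (s * a, t * b, - (t * c), s * d) :: int \<times> int \<times> int \<times> int"
  let ?g = "\<lambda>(a, b, c, d). ((sgn a, sgn b), (\<bar>a\<bar>, \<bar>b\<bar>, \<bar>c\<bar>, \<bar>d\<bar>)) :: (int \<times> int) \<times> (int \<times> int \<times> int \<times> int)"
  let ?D = "({-1 :: int, 1} \<times> {-1 :: int, 1}) \<times> det_solutions n K"
  have signs: "a * d > 0 \<and> b * c < 0" if "(a, b, c, d) \<in> box_dets n K" for a b c d
  proof -
    have "\<bar>a\<bar> * \<bar>d\<bar> \<le> K * K" "\<bar>b\<bar> * \<bar>c\<bar> \<le> K * K"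
      using that by (intro mult_mono; auto simp: box_dets_def)+
    then have "\<bar>a * d\<bar> < n" "\<bar>b * c\<bar> < n"
      using K by (simp_all add: abs_mult power2_eq_square)
    moreover have "a * d - b * c = n" using that by (simp add: box_dets_def)
    ultimately show ?thesis by linarith
  qed
  have inv: "?g q \<in> ?D \<and> ?f (?g q) = q" if q: "q \<in> box_dets n K" for q
  proof -
    obtain a b c d where abcd: "q = (a, b, c, d)" by (rule prod_cases4)
    have h: "a * d > 0" "b * c < 0" "\<bar>a\<bar> \<le> K" "\<bar>b\<bar> \<le> K" "\<bar>c\<bar> \<le> K" "\<bar>d\<bar> \<le> K" "a * d - b * c = n"
      using signs q abcd by (auto simp: box_dets_def)
    have "a > 0 \<and> d > 0 \<or> a < 0 \<and> d < 0" "b > 0 \<and> c < 0 \<or> b < 0 \<and> c > 0"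
      using h by (auto simp: zero_less_mult_iff mult_less_0_iff)
    then show ?thesis
      using h abcd by (auto simp: det_solutions_def)
  qed
  have "card ?D = card (box_dets n K)"
  proof (rule bij_betw_same_card[where f = ?f], rule bij_betw_byWitness[where f' = ?g])
    show "\<forall>x\<in>?D. ?g (?f x) = x"
      by (auto simp: det_solutions_def abs_mult sgn_mult)
    show "\<forall>q\<in>box_dets n K. ?f (?g q) = q" using inv by blast
    show "?f ` ?D \<subseteq> box_dets n K"
      by (auto simp: det_solutions_def box_dets_def abs_mult)
    show "?g ` box_dets n K \<subseteq> ?D" using inv by blast
  qed
  then show ?thesis
    by (simp add: card_cartesian_product)
qed

section \<open>The asymptotic count and its error terms\<close>

text \<open>The difference \<open>harm k - ln k\<close> is decreasing and equals 1 at
  \<open>k = 1\<close>.\<close>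

lemma harm_le_1_plus_ln:
  assumes "k > 0"
  shows "harm k \<le> 1 + ln (real k)"
proof -
  obtain m where m: "k = Suc m" using assms by (cases k) auto
  have "harm (Suc m) - ln (real (Suc m)) \<le> harm (Suc 0) - ln (real (Suc 0))"
    using decseq_harm_diff_ln by (rule decseqD) simp
  then show ?thesis by (simp add: m harm_def)
qed

text \<open>Three errors add up: that of the coprime pair count, with 32 = 4 * 2 * 4, that of
  replacing \<open>k\<^sup>2\<close> by \<open>n\<close>, and that of replacing
  \<open>totient n\<close> by \<open>n\<close>.\<close>

lemma card_det_solutions_asymp:
  fixes n k :: nat
  assumes "k > 0" and k: "k\<^sup>2 < n"
    and cop: "\<And>a. a \<in> {1..int k} \<Longrightarrow> coprime a (int n)"
    and thue: "\<And>u. coprime u (int n) \<Longrightarrow>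
      \<exists>x y. (x, y) \<noteq> (0, 0) \<and> \<bar>x\<bar> \<le> int k \<and> \<bar>y\<bar> \<le> int k \<and> [x * u = y] (mod int n)"
  shows "\<bar>4 * real (card (det_solutions (int n) (int k))) - 4 * (12 / pi\<^sup>2 - 1) * real n\<bar>
    \<le> 32 * (real k * (1 + ln (real k))) + 8 * (real n - (real k)\<^sup>2) + 4 * (real n - real (totient n))"
proof -
  define W where "W = real (card (det_solutions (int n) (int k)))"
  define Q where "Q = real (card (coprime_pairs (int k)))"
  have "1 \<le> k\<^sup>2" using assms(1) by simp
  then have "int n > 1" using k by linarith
  moreover have "(int k)\<^sup>2 < int n" using k by (metis of_nat_less_iff of_nat_power)
  ultimately have "card (det_solutions (int n) (int k)) + totient (nat (int n)) = 2 * card (coprime_pairs (int k))"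
    using cop thue by (rule card_det_solutions)
  then have W: "W = 2 * Q - real (totient n)"
    unfolding W_def Q_def nat_int by linarith
  have "\<bar>Q - 6 / pi\<^sup>2 * (real k)\<^sup>2\<bar> \<le> 4 * (real k * harm k)"
    using card_coprime_pairs_asymp[OF assms(1)] by (simp add: Q_def card_coprime_pairs_int)
  also have "\<dots> \<le> 4 * (real k * (1 + ln (real k)))"
    using harm_le_1_plus_ln[OF assms(1)] by (simp add: mult_left_mono)
  finally have Q: "\<bar>Q - 6 / pi\<^sup>2 * (real k)\<^sup>2\<bar> \<le> 4 * (real k * (1 + ln (real k)))" .
  have d: "(real k)\<^sup>2 \<le> real n" using k by (metis of_nat_power of_nat_le_iff less_imp_le)
  have c: "0 \<le> 6 / pi\<^sup>2" "6 / pi\<^sup>2 \<le> 1"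
    using pi_gt3 power_mono[of 3 pi 2] by simp_all
  have e: "0 \<le> 6 / pi\<^sup>2 * (real n - (real k)\<^sup>2)"
      "6 / pi\<^sup>2 * (real n - (real k)\<^sup>2) \<le> real n - (real k)\<^sup>2"
    using d c by (auto simp only: mult_nonneg_nonneg mult_left_le_one_le diff_ge_0_iff_ge)
  have t: "real (totient n) \<le> real n" by (simp add: totient_le)
  \<comment> \<open>Naming the nonlinear quantities by variables reduces the estimate to linear
    arithmetic.\<close>
  have combine: "\<bar>x\<bar> \<le> 32 * L + 8 * D + 4 * s"
    if "x = 8 * q - 8 * y + 4 * s" "\<bar>q\<bar> \<le> 4 * L" "0 \<le> y" "y \<le> D" "0 \<le> s" for x q y s L D :: real
    using that by linarith
  have "4 * W - 4 * (12 / pi\<^sup>2 - 1) * real n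
      = 8 * (Q - 6 / pi\<^sup>2 * (real k)\<^sup>2) - 8 * (6 / pi\<^sup>2 * (real n - (real k)\<^sup>2))
        + 4 * (real n - real (totient n))"
    unfolding W by (simp add: algebra_simps diff_divide_distrib)
  from this Q e show ?thesis
    unfolding W_def[symmetric] by (rule combine) (use t in simp)
qed

text \<open>A lower bound away from 0 lets error terms without a logarithm be absorbed into those
  with one.\<close>

lemma half_le_ln_prime:
  assumes "prime (p :: nat)"
  shows "1 / 2 \<le> ln (real p)"
proof -
  have "1 / 2 \<le> ln (2 :: real)" using ln2_ge_two_thirds by simp
  also have "\<dots> \<le> ln (real p)" using prime_ge_2_nat[OF assms] by simp
  finally show ?thesis .
qed

lemma coprime_below_prime:
  fixes p :: nat and a :: int
  assumes "prime p" "0 < a" "a < int p"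
  shows "coprime a (int p)"
proof -
  have "\<not> int p dvd a" using assms by (auto dest: zdvd_imp_le)
  then show ?thesis
    using assms(1) by (metis coprime_commute prime_imp_coprime prime_nat_int_transfer)
qed

text \<open>Serves both cases, with \<open>y = ln p\<close> and \<open>r\<close> equal to
  \<open>sqrt p\<close> or \<open>p\<close>. Since \<open>r \<le> 2 * (r * y)\<close>, the constant
  is 152 = 32 * 3 + 8 * 6 + 4 * 2.\<close>

lemma error_terms_bound:
  fixes A B T r y :: real
  assumes "A \<le> r * (3 * y)" "B \<le> 3 * r" "T \<le> r" "1 / 2 \<le> y" "1 \<le> r"
  shows "32 * A + 8 * B + 4 * T \<le> 152 * (r * y)"
proof -
  have r: "r \<le> 2 * (r * y)"
    using mult_left_mono[OF assms(4), of r] assms(5) by simp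
  have "A \<le> 3 * (r * y)" using assms(1) by simp
  with r assms show "32 * A + 8 * B + 4 * T \<le> 152 * (r * y)" by linarith
qed

section \<open>Determinant \<open>p\<close>\<close>

text \<open>The integer part \<open>k\<close> of \<open>sqrt p\<close> satisfies
  \<open>k\<^sup>2 < p < (k + 1)\<^sup>2\<close>. The left inequality, strict because a prime is no
  square, keeps products of two entries below the determinant; the right one is the pigeonhole
  condition.\<close>

lemma matrix_count_prime_bound:
  assumes p: "prime p"
  shows "\<bar>real (matrix_count p (sqrt (real p))) - 4 * (12 / pi\<^sup>2 - 1) * real p\<bar>
    \<le> 152 * (sqrt (real p) * ln (real p))"
proof -
  define r where "r = sqrt (real p)"
  define k where "k = nat \<lfloor>r\<rfloor>"
  have p2: "p \<ge> 2" using p by (rule prime_ge_2_nat)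
  have r: "r \<ge> 1" "r\<^sup>2 = real p" using p2 by (simp_all add: r_def)
  have k: "k > 0" "int k = \<lfloor>r\<rfloor>" "real k \<le> r" "r < real k + 1"
    using r by (simp_all add: k_def)
  have "(real k)\<^sup>2 \<le> r\<^sup>2" using k by (intro power_mono) auto
  then have "real (k\<^sup>2) \<le> real p" by (simp add: r)
  then have "k\<^sup>2 \<le> p" by (simp only: of_nat_le_iff)
  moreover have "k\<^sup>2 \<noteq> p" using p prime_power_iff[of k 2] by auto
  ultimately have kp: "k\<^sup>2 < p" by simp
  have "r\<^sup>2 < (real k + 1)\<^sup>2" using k r by (intro power_strict_mono) auto
  then have pk: "real p < (real k + 1)\<^sup>2" by (simp add: r)
  have "k \<le> k * k" using k by simp
  then have klt: "k < p" using kp unfolding power2_eq_square by (rule le_less_trans)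
  have "int p < (int k + 1) * (int k + 1)"
  proof -
    have "real_of_int (int p) < real_of_int ((int k + 1) * (int k + 1))"
      using pk by (simp add: power2_eq_square)
    then show ?thesis by (simp only: of_int_less_iff)
  qed
  then have thue: "\<exists>x y. (x, y) \<noteq> (0, 0) \<and> \<bar>x\<bar> \<le> int k \<and> \<bar>y\<bar> \<le> int k \<and> [x * u = y] (mod int p)" for u
    using thue_pigeonhole[of "int p" "int k" "int k" u] p2 by (metis of_nat_0_le_iff of_nat_0_less_iff less_le_trans pos2)
  have count: "real (matrix_count p r) = 4 * real (card (det_solutions (int p) (int k)))"
  proof -
    have "(int k)\<^sup>2 < int p" using kp by (metis of_nat_less_iff of_nat_power)
    then show ?thesis
      by (simp add: matrix_count_eq_card_box_dets k(2)[symmetric] card_box_dets)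
  qed
  have lnp: "1 / 2 \<le> ln (real p)" using p by (rule half_le_ln_prime)
  have bound: "\<bar>real (matrix_count p r) - 4 * (12 / pi\<^sup>2 - 1) * real p\<bar>
      \<le> 32 * (real k * (1 + ln (real k))) + 8 * (real p - (real k)\<^sup>2) + 4 * (real p - real (totient p))"
    unfolding count using k(1) kp
  proof (rule card_det_solutions_asymp)
    fix a assume "a \<in> {1..int k}"
    then show "coprime a (int p)" using klt by (intro coprime_below_prime[OF p]) auto
  qed (rule thue)
  have "real k \<le> real p" using klt by simp
  then have "ln (real k) \<le> ln (real p)" using k by simp
  then have "real k * (1 + ln (real k)) \<le> r * (3 * ln (real p))"
    using k lnp r by (intro mult_mono) auto
  \<comment> \<open>The gap is below \<open>(k + 1)\<^sup>2 - k\<^sup>2 = 2 * k + 1\<close>, hence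
    below \<open>3 * r\<close>.\<close>
  moreover have "real p - (real k)\<^sup>2 \<le> 3 * r"
    using pk k r by (simp add: power2_eq_square algebra_simps)
  moreover have "real p - real (totient p) \<le> r"
    using p p2 r(1) by (simp add: totient_prime of_nat_diff)
  ultimately have "32 * (real k * (1 + ln (real k))) + 8 * (real p - (real k)\<^sup>2) + 4 * (real p - real (totient p))
      \<le> 152 * (r * ln (real p))"
    using lnp r(1) by (rule error_terms_bound)
  with bound show ?thesis unfolding r_def[symmetric] by (rule order_trans)
qed

section \<open>Determinant \<open>p\<^sup>2\<close>\<close>

text \<open>If \<open>\<bar>a\<bar> = p\<close>, then \<open>p\<close> divides \<open>b c\<close>, so \<open>b\<close> or \<open>c\<close> is \<open>0\<close> or \<open>p\<close> up to sign, and \<open>d\<close> is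
  determined by the other three entries. The other entries are moved to position \<open>a\<close> by symmetries
  preserving \<open>a d - b c\<close>.\<close>

lemma card_box_dets_extremal_entry:
  assumes p: "prime p"
  shows "card {(a, b, c, d) \<in> box_dets (int (p\<^sup>2)) (int p). int p \<in> {\<bar>a\<bar>, \<bar>b\<bar>, \<bar>c\<bar>, \<bar>d\<bar>}}
    \<le> 48 * (2 * p + 1)"
proof -
  let ?B = "box_dets (int (p\<^sup>2)) (int p)"
  let ?P = "int p"
  define F where "F = {(a, b, c, d) \<in> ?B. \<bar>a\<bar> = ?P}"
  let ?R = "{- ?P, ?P} \<times> {- ?P, 0, ?P} \<times> {- ?P..?P}"
  define g where "g = (\<lambda>(a, b, c). (a, b, c, (?P * ?P + b * c) div a))"
  \<comment> \<open>\<open>h\<close> reads \<open>c\<close> before \<open>b\<close>, so that the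
    same parameter set \<open>?R\<close> also covers the case where \<open>c\<close> is the entry
    with only three possible values. The division recovering \<open>d\<close> is exact.\<close>
  define h where "h = (\<lambda>(a, c, b). (a, b, c, (?P * ?P + b * c) div a))"
  have p0: "p > 0" using p by (rule prime_gt_0_nat)
  have mult: "x \<in> {- ?P, 0, ?P}" if "?P dvd x" "\<bar>x\<bar> \<le> ?P" for x
    using that p0 dvd_imp_le_int[of x ?P] by (cases "x = 0") (auto simp: abs_if split: if_splits)
  have "F \<subseteq> g ` ?R \<union> h ` ?R"
  proof
    fix q assume "q \<in> F"
    then obtain a b c d where q: "q = (a, b, c, d)" "(a, b, c, d) \<in> ?B" "\<bar>a\<bar> = ?P"
      by (auto simp: F_def)
    have r: "\<bar>b\<bar> \<le> ?P" "\<bar>c\<bar> \<le> ?P" "a * d = ?P * ?P + b * c" "a \<in> {- ?P, ?P}" "a \<noteq> 0"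
      using q p0 by (auto simp: box_dets_def power2_eq_square)
    have d: "d = (?P * ?P + b * c) div a" unfolding r(3)[symmetric] using r(5) by simp
    have "?P dvd a" using r(4) by auto
    then have "?P dvd a * d - ?P * ?P" by simp
    then have "?P dvd b * c" by (simp add: r(3))
    then have "?P dvd b \<or> ?P dvd c"
      using p prime_dvd_mult_iff[of ?P b c] by simp
    then have "b \<in> {- ?P, 0, ?P} \<or> c \<in> {- ?P, 0, ?P}" using mult r by blast
    then show "q \<in> g ` ?R \<union> h ` ?R"
    proof
      assume "b \<in> {- ?P, 0, ?P}"
      then have "(a, b, c) \<in> ?R" using r by auto
      moreover have "q = g (a, b, c)" using q d by (simp add: g_def)
      ultimately show ?thesis by blast
    next
      assume "c \<in> {- ?P, 0, ?P}"
      then have "(a, c, b) \<in> ?R" using r by auto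
      moreover have "q = h (a, c, b)" using q d by (simp add: h_def)
      ultimately show ?thesis by blast
    qed
  qed
  then have "card F \<le> card (g ` ?R \<union> h ` ?R)"
    by (intro card_mono) auto
  also have "\<dots> \<le> card ?R + card ?R"
    by (intro card_Un_le[THEN order_trans] add_mono card_image_le) auto
  also have "card ?R \<le> 2 * (3 * (2 * p + 1))"
    unfolding card_cartesian_product by (intro mult_mono) (auto simp: card_insert_if)
  finally have F: "card F \<le> 12 * (2 * p + 1)" by simp
  have finF: "finite F"
    by (rule finite_subset[OF _ finite_box_dets[of "int (p\<^sup>2)" ?P]]) (auto simp: F_def)
  \<comment> \<open>\<open>?s1\<close> and \<open>?s2\<close> are involutions. \<open>?s3\<close>
    squares to negation, so its inverse \<open>?s3'\<close> is needed as well. With four positions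
    of the entry, 48 = 4 * 12.\<close>
  let ?s1 = "\<lambda>(a, b, c, d). (d, b, c, a) :: int \<times> int \<times> int \<times> int"
  let ?s2 = "\<lambda>(a, b, c, d). (b, a, - d, - c) :: int \<times> int \<times> int \<times> int"
  let ?s3 = "\<lambda>(a, b, c, d). (c, d, - a, - b) :: int \<times> int \<times> int \<times> int"
  let ?s3' = "\<lambda>(a, b, c, d). (- c, - d, a, b) :: int \<times> int \<times> int \<times> int"
  have "{(a, b, c, d) \<in> ?B. ?P \<in> {\<bar>a\<bar>, \<bar>b\<bar>, \<bar>c\<bar>, \<bar>d\<bar>}} \<subseteq> (F \<union> ?s1 ` F) \<union> (?s2 ` F \<union> ?s3' ` F)"
    (is "?L \<subseteq> ?M")
  proof
    fix w assume "w \<in> ?L"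
    then obtain a b c d where w: "w = (a, b, c, d)"
      and q: "(a, b, c, d) \<in> ?B" "?P \<in> {\<bar>a\<bar>, \<bar>b\<bar>, \<bar>c\<bar>, \<bar>d\<bar>}"
      by blast
    consider "\<bar>a\<bar> = ?P" | "\<bar>b\<bar> = ?P" | "\<bar>c\<bar> = ?P" | "\<bar>d\<bar> = ?P" using q(2) by auto
    then show "w \<in> ?M"
    proof cases
      case 1
      then show ?thesis using q w by (simp add: F_def)
    next
      case 2
      then have "?s2 (a, b, c, d) \<in> F" using q by (simp add: F_def box_dets_def algebra_simps)
      then have "?s2 (?s2 (a, b, c, d)) \<in> ?s2 ` F" by (rule imageI)
      then show ?thesis using w by simp
    next
      case 3
      then have "?s3 (a, b, c, d) \<in> F" using q by (simp add: F_def box_dets_def algebra_simps)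
      then have "?s3' (?s3 (a, b, c, d)) \<in> ?s3' ` F" by (rule imageI)
      then show ?thesis using w by simp
    next
      case 4
      then have "?s1 (a, b, c, d) \<in> F" using q by (simp add: F_def box_dets_def algebra_simps)
      then have "?s1 (?s1 (a, b, c, d)) \<in> ?s1 ` F" by (rule imageI)
      then show ?thesis using w by simp
    qed
  qed
  then have "card {(a, b, c, d) \<in> ?B. ?P \<in> {\<bar>a\<bar>, \<bar>b\<bar>, \<bar>c\<bar>, \<bar>d\<bar>}}
      \<le> card ((F \<union> ?s1 ` F) \<union> (?s2 ` F \<union> ?s3' ` F))"
    using finF by (intro card_mono) auto
  also have "\<dots> \<le> (card F + card F) + (card F + card F)"
    using finF by (intro card_Un_le[THEN order_trans] add_mono card_image_le) auto
  also have "\<dots> \<le> 48 * (2 * p + 1)" using F by simp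
  finally show ?thesis .
qed

text \<open>The exact count is applied with \<open>k = p - 1\<close>, because the entry
  \<open>p\<close> is not coprime to \<open>p\<^sup>2\<close> and
  \<open>k\<^sup>2 < p\<^sup>2\<close> must be strict. Matrices with an entry of absolute value
  \<open>p\<close> form the additional error \<open>E\<close>.\<close>

lemma matrix_count_prime_square_bound:
  assumes p: "prime p"
  shows "\<bar>real (matrix_count (p\<^sup>2) (real p)) - 4 * (12 / pi\<^sup>2 - 1) * (real p)\<^sup>2\<bar>
    \<le> 392 * (real p * ln (real p))"
proof -
  define k where "k = p - 1"
  have p2: "p \<ge> 2" using p by (rule prime_ge_2_nat)
  have k: "k > 0" "k < p" "int k = int p - 1" "real k = real p - 1"
    using p2 by (simp_all add: k_def of_nat_diff)
  have kp: "k\<^sup>2 < p\<^sup>2" using k by (intro power_strict_mono) auto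
  have cop: "coprime a (int (p\<^sup>2))" if "a \<in> {1..int k}" for a
    using coprime_below_prime[OF p, of a] that k by (simp add: coprime_power_right_iff)
  have thue: "\<exists>x y. (x, y) \<noteq> (0, 0) \<and> \<bar>x\<bar> \<le> int k \<and> \<bar>y\<bar> \<le> int k \<and> [x * u = y] (mod int (p\<^sup>2))"
    if u: "coprime u (int (p\<^sup>2))" for u
  proof -
    have "(int p + 1) * (int k + 1) > int (p\<^sup>2)"
      using p2 unfolding k(3) by (simp add: power2_eq_square algebra_simps)
    then obtain x y where xy: "(x, y) \<noteq> (0, 0)" "\<bar>x\<bar> \<le> int p" "\<bar>y\<bar> \<le> int k" "[x * u = y] (mod int (p\<^sup>2))"
      using thue_pigeonhole[of "int (p\<^sup>2)" "int p" "int k" u] p2 by auto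
    have dv: "int p * int p dvd x * u - y"
      using xy(4) by (simp add: cong_iff_dvd_diff power2_eq_square)
    \<comment> \<open>As \<open>(k + 1)\<^sup>2 = n\<close> is just too small for the pigeonhole principle, \<open>x\<close> was allowed one more value.\<close>
    have "\<bar>x\<bar> \<noteq> int p"
    proof
      assume x: "\<bar>x\<bar> = int p"
      \<comment> \<open>From \<open>p dvd x\<close> follows \<open>p dvd y\<close>, and
        \<open>\<bar>y\<bar> < p\<close> forces \<open>y = 0\<close>. Then \<open>p * p\<close>
        divides \<open>x * u\<close>, hence \<open>x\<close>, contradicting
        \<open>\<bar>x\<bar> = p\<close>.\<close>
      then have px: "int p dvd x" by (metis dvd_abs_iff dvd_refl)
      have "int p dvd x * u - y" using dv by (rule dvd_mult_left)
      then have "int p dvd x * u - (x * u - y)" by (rule dvd_diff[OF dvd_mult2[OF px]])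
      then have "int p dvd y" by simp
      then have "y = 0" using xy(3) k dvd_imp_le_int[of y "int p"] by auto
      then have "int p * int p dvd x * u" using dv by simp
      moreover have "coprime (int p * int p) u"
        using u by (simp add: power2_eq_square coprime_commute)
      ultimately have "int p * int p dvd x" by (simp add: coprime_dvd_mult_left_iff)
      then have "int p * int p dvd int p" using x by (metis dvd_abs_iff)
      then have "int p * int p \<le> int p" using p2 by (intro zdvd_imp_le) auto
      then show False using p2 by simp
    qed
    then have "\<bar>x\<bar> \<le> int k" using xy(2) k by linarith
    then show ?thesis using xy by blast
  qed
  let ?B = "box_dets (int (p\<^sup>2)) (int p)"
  let ?B' = "box_dets (int (p\<^sup>2)) (int k)"
  have sub: "?B' \<subseteq> ?B" using k by (auto simp: box_dets_def)
  have B': "card ?B' = 4 * card (det_solutions (int (p\<^sup>2)) (int k))"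
    using kp by (intro card_box_dets) (metis of_nat_less_iff of_nat_power)
  define E where "E = card (?B - ?B')"
  have "card ?B = card ?B' + E"
    unfolding E_def using sub finite_box_dets by (metis card_mono card_Diff_subset finite_subset le_add_diff_inverse)
  then have count: "real (matrix_count (p\<^sup>2) (real p)) = 4 * real (card (det_solutions (int (p\<^sup>2)) (int k))) + real E"
    by (simp add: matrix_count_eq_card_box_dets B' del: of_nat_power)
  have "?B - ?B' \<subseteq> {(a, b, c, d) \<in> ?B. int p \<in> {\<bar>a\<bar>, \<bar>b\<bar>, \<bar>c\<bar>, \<bar>d\<bar>}}"
    using k by (auto simp: box_dets_def)
  then have "E \<le> card {(a, b, c, d) \<in> ?B. int p \<in> {\<bar>a\<bar>, \<bar>b\<bar>, \<bar>c\<bar>, \<bar>d\<bar>}}"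
    unfolding E_def by (intro card_mono finite_subset[OF _ finite_box_dets[of "int (p\<^sup>2)" "int p"]]) auto
  also have "\<dots> \<le> 48 * (2 * p + 1)"
    using p by (rule card_box_dets_extremal_entry)
  finally have "real E \<le> real (48 * (2 * p + 1))" by (simp only: of_nat_le_iff)
  \<comment> \<open>Here \<open>48 \<le> 24 * p\<close>.\<close>
  also have "\<dots> \<le> 120 * real p" using p2 by simp
  finally have E: "real E \<le> 120 * real p" .
  have lnp: "1 / 2 \<le> ln (real p)" using p by (rule half_le_ln_prime)
  have one_le: "1 \<le> real p" using p2 by simp
  have le_log: "real p \<le> 2 * (real p * ln (real p))"
    using mult_left_mono[OF lnp, of "real p"] by simp
  define Z where "Z = 4 * (12 / pi\<^sup>2 - 1) * (real p)\<^sup>2"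
  have bound: "\<bar>4 * real (card (det_solutions (int (p\<^sup>2)) (int k))) - Z\<bar>
      \<le> 32 * (real k * (1 + ln (real k))) + 8 * (real (p\<^sup>2) - (real k)\<^sup>2) + 4 * (real (p\<^sup>2) - real (totient (p\<^sup>2)))"
    using card_det_solutions_asymp[OF k(1) kp cop thue] by (simp add: Z_def)
  have "ln (real k) \<le> ln (real p)" using k by simp
  then have "1 + ln (real k) \<le> 3 * ln (real p)" using lnp by linarith
  then have "real k * (1 + ln (real k)) \<le> real p * (3 * ln (real p))"
    using k(1,2) by (intro mult_mono) auto
  moreover have "real (p\<^sup>2) - (real k)\<^sup>2 \<le> 3 * real p"
    unfolding k(4) by (simp add: power2_eq_square algebra_simps)
  moreover have "real (p\<^sup>2) - real (totient (p\<^sup>2)) \<le> real p"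
  proof -
    have "totient (p\<^sup>2) = p * (p - 1)"
      using totient_prime_power[OF p, of 2] by simp
    then show ?thesis
      using p2 by (simp add: of_nat_diff power2_eq_square algebra_simps)
  qed
  ultimately have "32 * (real k * (1 + ln (real k))) + 8 * (real (p\<^sup>2) - (real k)\<^sup>2) + 4 * (real (p\<^sup>2) - real (totient (p\<^sup>2)))
      \<le> 152 * (real p * ln (real p))"
    using lnp one_le by (rule error_terms_bound)
  \<comment> \<open>The total is 392 = 152 + 2 * 120, the bound on \<open>E\<close> being absorbed
    by \<open>le_log\<close>.\<close>
  then show ?thesis
    using bound E le_log unfolding count Z_def[symmetric] by linarith
qed

theorem theorem2:
  shows "(\<exists>C::real. \<forall>p::nat. prime p \<longrightarrow>
            \<bar>real (matrix_count p (sqrt (real p))) - 4 * (12 / pi\<^sup>2 - 1) * real p\<bar>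
              \<le> C * (sqrt (real p) * ln (real p))) \<and>
         (\<exists>C::real. \<forall>p::nat. prime p \<longrightarrow>
            \<bar>real (matrix_count (p\<^sup>2) (real p)) - 4 * (12 / pi\<^sup>2 - 1) * (real p)\<^sup>2\<bar>
              \<le> C * (real p * ln (real p)))"
  using matrix_count_prime_bound matrix_count_prime_square_bound by blast

end
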